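(* Let $\mathcal{L}=(L,\wedge,\vee,\otimes,0,1)$ be an integral $\ell$-monoid, let $\alpha$ be a fuzzy regular expression over a finite alphabet $X$, let $Y$ be an alphabet associated with $\alpha$, and let $\mathcal A=(A,X\cup Y,\delta^A,a_0,\tau^A)$ be an arbitrary nondeterministic (finite) automaton which recognizes $\|\alpha_R\|$. Define $\mathcal A_\alpha=(A_\alpha,X,\delta^{A_\alpha},a_0,\tau^{A_\alpha})$ by $A_\alpha=A$, with the same single crisp initial state $a_0$, and $$\delta^{A_\alpha}(a,x,b)=\bigvee_{v\in U_Y(x)}\varphi_\alpha^*(v)\otimes\delta^A(a,v,b),\qquad \tau^{A_\alpha}(a)=\bigvee_{v\in Y^*}\bigvee_{b\in A}\varphi_\alpha^*(v)\otimes\delta^A(a,v,b)\otimes\tau^A(b)$$ for all $a,b\in A$ and $x\in X$. Then $\mathcal A_\alpha$ is a well-defined fuzzy automaton (i.e. all these suprema exist in $L$) and it recognizes the fuzzy language $\|\alpha\|$, i.e. $L(\mathcal A_\alpha)=\|\alpha\|$.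
   Context: **Integral $\ell$-monoid.** An algebra $(L,\wedge,\vee,\otimes,0,1)$ such that $(L,\wedge,\vee,0,1)$ is a lattice with least element $0$ and greatest element $1$ (not necessarily complete), $(L,\otimes,1)$ is a (not necessarily commutative) monoid whose unit is the greatest element $1$, $x\otimes 0=0\otimes x=0$, $x\otimes(y\vee z)=(x\otimes y)\vee(x\otimes z)$ and $(x\vee y)\otimes z=(x\otimes z)\vee(y\otimes z)$ for all $x,y,z\in L$. **Fuzzy languages.** A fuzzy language over an alphabet $Z$ is a map $f:Z^*\to L$ ($\varepsilon$ is the empty word). For $\lambda\in L$: $(\lambda\otimes f)(u)=\lambda\otimes f(u)$; $(f\vee g)(u)=f(u)\vee g(u)$; $(fg)(u)=\bigvee_{u=vw}f(v)\otimes g(w)$; $f^0$ is the characteristic function of $\{\varepsilon\}$, $f^{n+1}=f^nf$, and $f^*=\bigvee_{n\ge 0}f^n$ pointwise (this supremum exists because $\mathcal L$ is integral). **Fuzzy regular expressions** over a finite alphabet $X$ are defined inductively: $\emptyset$, $\varepsilon$ and each $x\in X$ are fuzzy regular expressions; if $\alpha,\alpha_1,\alpha_2$ are, then so are $(\lambda\alpha)$ for $\lambda\in L$, $(\alpha_1+\alpha_2)$, $(\alpha_1\alpha_2)$ and $(\alpha^* )$. The fuzzy language $\|\alpha\|:X^*\to L$ is defined by: $\|\emptyset\|=0$ identically; for $\alpha\in X\cup\{\varepsilon\}$, $\|\alpha\|(u)=1$ if $u=\alpha$ and $0$ otherwise; $\|\lambda\alpha\|=\lambda\otimes\|\alpha\|$;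 $\|\alpha_1+\alpha_2\|=\|\alpha_1\|\vee\|\alpha_2\|$; $\|\alpha_1\alpha_2\|=\|\alpha_1\|\,\|\alpha_2\|$; $\|\alpha^*\|=\|\alpha\|^*$. A regular expression is a fuzzy regular expression without scalars; its fuzzy language takes values in $\{0,1\}$. **The regular expression $\alpha_R$.** Let $K\subseteq L$ be the (finite, possibly empty) set of scalars appearing in $\alpha$. An alphabet associated with $\alpha$ is a set $Y$ with $Y\cap X=\emptyset$ together with a bijection $K\to Y$, $\lambda\mapsto\lambda'$. Then $\alpha_R$ is the regular expression over $X\cup Y$ obtained from $\alpha$ by replacing each scalar $\lambda$ by the letter $\lambda'$ (so scalar multiplication by $\lambda$ becomes concatenation with $\lambda'$ on the left), and $\|\alpha_R\|:(X\cup Y)^*\to\{0,1\}\subseteq L$. The map $\varphi_\alpha^*:(X\cup Y)^*\to(L,\otimes,1)$ is the monoid homomorphism with $\varphi_\alpha^*(x)=1$ for $x\in X$ and $\varphi_\alpha^*(\lambda')=\lambda$ for $\lambda'\in Y$. **$U_Y(u)$.** For $u\in X^*$, $U_Y(u)\subseteq(X\cup Y)^*$ is the set of all words over $X\cup Y$ that become $u$ after deletion of all letters from $Y$ (the shuffle of $u$ with $Y^*$). In particular $U_Y(x)=Y^*xY^*$ for $x\in X$. **Fuzzy automata.** A fuzzy automaton with a single crisp initial state is $\mathcal B=(B,Z,\delta^B,b_0,\tau^B)$ with $B$ a finite nonempty set, $Z$ a finite alphabet, $\delta^B:B\times Z\times B\to L$, $b_0\in B$, $\tau^B:B\to L$.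 The map $\delta^B$ is extended to $B\times Z^*\times B$ by $\delta^B(a,\varepsilon,b)=1$ if $a=b$ and $0$ otherwise, and $\delta^B(a,ux,b)=\bigvee_{c\in B}\delta^B(a,u,c)\otimes\delta^B(c,x,b)$. The fuzzy language recognized by $\mathcal B$ is $L(\mathcal B)(u)=\bigvee_{b\in B}\delta^B(b_0,u,b)\otimes\tau^B(b)$, $u\in Z^*$. A nondeterministic automaton is a fuzzy automaton for which $\delta^B$ (on letters) and $\tau^B$ take values in $\{0,1\}$. *)

theory Defs
  imports Main "HOL-Library.Lub_Glb"
begin

section \<open>Integral l-monoids\<close>

text \<open>The lattice bounds are \<open>bot\<close> and \<open>top\<close>; \<open>bot\<close> plays the role of \<open>0\<close>, and the monoid unit
  \<open>1\<close> is the greatest element. Completeness is not assumed.\<close>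

class integral_l_monoid = bounded_lattice + monoid_mult +
  assumes top_eq_one: "top = 1"
    and mult_bot_right: "x * bot = bot"
    and mult_bot_left: "bot * x = bot"
    and mult_sup_distrib: "x * sup y z = sup (x * y) (x * z)"
    and sup_mult_distrib: "sup x y * z = sup (x * z) (y * z)"

text \<open>Supremum of an arbitrary set, meaningful only if that supremum exists. Suprema of finite nonempty
  sets are written with the library's \<open>Sup_fin\<close>.\<close>

definition lub :: "'l::order set \<Rightarrow> 'l" where
  "lub S = (THE s. isLub UNIV S s)"

lemma isLub_UNIV_iff:
  fixes S :: "'l::order set"
  shows "isLub UNIV S s \<longleftrightarrow> (\<forall>x\<in>S. x \<le> s) \<and> (\<forall>t. (\<forall>x\<in>S. x \<le> t) \<longrightarrow> s \<le> t)"
  by (auto simp: isLub_def leastP_def isUb_def setle_def setge_def)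

lemma lub_eqI:
  fixes S :: "'l::order set"
  assumes "isLub UNIV S s"
  shows "lub S = s"
  unfolding lub_def
  using assms by (intro the_equality) (auto simp: isLub_UNIV_iff intro: order.antisym)


section \<open>Fuzzy languages\<close>

type_synonym ('c, 'l) fuzzy_language = "'c list \<Rightarrow> 'l"

definition fl_conc ::
  "('c, 'l::integral_l_monoid) fuzzy_language \<Rightarrow> ('c, 'l) fuzzy_language \<Rightarrow> ('c, 'l) fuzzy_language" where
  "fl_conc f g u = Sup_fin {f v * g w |v w. u = v @ w}"

primrec fl_pow :: "('c, 'l::integral_l_monoid) fuzzy_language \<Rightarrow> nat \<Rightarrow> ('c, 'l) fuzzy_language" where
  "fl_pow f 0 = (\<lambda>u. if u = [] then 1 else bot)"
| "fl_pow f (Suc n) = fl_conc (fl_pow f n) f"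

definition fl_star :: "('c, 'l::integral_l_monoid) fuzzy_language \<Rightarrow> ('c, 'l) fuzzy_language" where
  "fl_star f u = lub (range (\<lambda>n. fl_pow f n u))"

text \<open>The supremum in the definition of \<open>fl_star\<close> always exists: by integrality, powers beyond the length
  of the word contribute nothing new.\<close>

lemma finite_splits: "finite {f v w |v w. u = v @ w}"
proof -
  have "{f v w |v w. u = v @ w} \<subseteq> (\<lambda>i. f (take i u) (drop i u)) ` {..length u}"
  proof
    fix x assume "x \<in> {f v w |v w. u = v @ w}"
    then obtain v w where "x = f v w" "u = v @ w" by blast
    then show "x \<in> (\<lambda>i. f (take i u) (drop i u)) ` {..length u}"
      by (intro image_eqI[of _ _ "length v"]) auto
  qed
  then show ?thesis by (rule finite_subset) simp
qed

lemma one_greatest: "(x::'l::integral_l_monoid) \<le> 1"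
  using top_greatest[of x] by (simp add: top_eq_one)

lemma mult_left_mono_l: "(x::'l::integral_l_monoid) \<le> y \<Longrightarrow> x * z \<le> y * z"
  by (metis le_iff_sup sup_mult_distrib)

lemma mult_right_mono_l: "(x::'l::integral_l_monoid) \<le> y \<Longrightarrow> z * x \<le> z * y"
  by (metis le_iff_sup mult_sup_distrib)

lemma fl_conc_ge: "u = v @ w \<Longrightarrow> f v * g w \<le> fl_conc f g u"
  unfolding fl_conc_def by (intro Sup_fin.coboundedI finite_splits) auto

lemma fl_conc_le:
  assumes "\<And>v w. u = v @ w \<Longrightarrow> f v * g w \<le> t"
  shows "fl_conc f g u \<le> t"
  unfolding fl_conc_def
proof (rule Sup_fin.boundedI[OF finite_splits])
  show "{f v * g w |v w. u = v @ w} \<noteq> {}" by auto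
qed (use assms in auto)

lemma mult_Sup_fin:
  fixes A :: "'l::integral_l_monoid set"
  assumes "finite A" "A \<noteq> {}"
  shows "Sup_fin A * z = Sup_fin ((\<lambda>x. x * z) ` A)"
  using assms by (induction A rule: finite_ne_induct) (auto simp: sup_mult_distrib)

lemma fl_pow_le:
  "fl_pow f n u \<le> Sup_fin ((\<lambda>k. fl_pow f k u) ` {..length u})"
proof (induction n arbitrary: u)
  case 0
  have "fl_pow f 0 u \<in> (\<lambda>k. fl_pow f k u) ` {..length u}" by blast
  then show ?case by (intro Sup_fin.coboundedI) simp
next
  case (Suc n)
  let ?S = "\<lambda>v. Sup_fin ((\<lambda>k. fl_pow f k v) ` {..length v})"
  show ?case unfolding fl_pow.simps
  proof (rule fl_conc_le)
    fix v w assume u: "u = v @ w"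
    show "fl_pow f n v * f w \<le> ?S u"
    proof (cases "w = []")
      case True
      have "fl_pow f n v * f w \<le> fl_pow f n v"
        using mult_right_mono_l[OF one_greatest, of "fl_pow f n v" "f w"] by simp
      also have "\<dots> \<le> ?S u" using Suc[of u] u True by simp
      finally show ?thesis .
    next
      case False
      have "fl_pow f n v * f w \<le> ?S v * f w" by (rule mult_left_mono_l[OF Suc])
      also have "\<dots> = Sup_fin ((\<lambda>x. x * f w) ` (\<lambda>k. fl_pow f k v) ` {..length v})"
        by (rule mult_Sup_fin) auto
      also have "\<dots> \<le> ?S u"
      proof (rule Sup_fin.boundedI)
        fix a assume "a \<in> (\<lambda>x. x * f w) ` (\<lambda>k. fl_pow f k v) ` {..length v}"
        then obtain k where k: "k \<le> length v" "a = fl_pow f k v * f w" by auto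
        have "a \<le> fl_pow f (Suc k) u" using fl_conc_ge[OF u] k by simp
        also have "\<dots> \<le> ?S u"
        proof (rule Sup_fin.coboundedI)
          have "Suc k \<le> length u" using k u False by (cases w) auto
          then show "fl_pow f (Suc k) u \<in> (\<lambda>k. fl_pow f k u) ` {..length u}" by blast
        qed simp
        finally show "a \<le> ?S u" .
      qed auto
      finally show ?thesis .
    qed
  qed
qed

lemma fl_star_isLub: "isLub UNIV (range (\<lambda>n. fl_pow f n u)) (fl_star f u)"
proof -
  have "isLub UNIV (range (\<lambda>n. fl_pow f n u)) (Sup_fin ((\<lambda>k. fl_pow f k u) ` {..length u}))"
    unfolding isLub_UNIV_iff by (auto intro!: fl_pow_le Sup_fin.boundedI)
  then show ?thesis unfolding fl_star_def using lub_eqI by metis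
qed


section \<open>Fuzzy regular expressions\<close>

text \<open>The set functions \<open>scalars\<close> and \<open>letters\<close> collect the scalars and letters occurring in an
  expression; \<open>\<alpha>\<close> is an expression over \<open>X\<close> iff \<open>letters \<alpha> \<subseteq> X\<close>, and it is an (ordinary) regular
  expression iff \<open>scalars \<alpha> = {}\<close>.\<close>

datatype (scalars: 'l, letters: 'c) fre =
    Empty
  | Eps
  | Letter 'c
  | Scal 'l "('l, 'c) fre"
  | Plus "('l, 'c) fre" "('l, 'c) fre"
  | Conc "('l, 'c) fre" "('l, 'c) fre"
  | Star "('l, 'c) fre"

primrec sem :: "('l::integral_l_monoid, 'c) fre \<Rightarrow> ('c, 'l) fuzzy_language" where
  "sem Empty = (\<lambda>u. bot)"
| "sem Eps = (\<lambda>u. if u = [] then 1 else bot)"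
| "sem (Letter x) = (\<lambda>u. if u = [x] then 1 else bot)"
| "sem (Scal l a) = (\<lambda>u. l * sem a u)"
| "sem (Plus a b) = (\<lambda>u. sup (sem a u) (sem b u))"
| "sem (Conc a b) = fl_conc (sem a) (sem b)"
| "sem (Star a) = fl_star (sem a)"

text \<open>An alphabet associated with \<open>\<alpha>\<close>; the map \<open>p\<close> is \<open>\<lambda> \<mapsto> \<lambda>'\<close>.\<close>

definition associated_alphabet :: "('l, 'c) fre \<Rightarrow> 'c set \<Rightarrow> 'c set \<Rightarrow> ('l \<Rightarrow> 'c) \<Rightarrow> bool" where
  "associated_alphabet \<alpha> X Y p \<longleftrightarrow> Y \<inter> X = {} \<and> bij_betw p (scalars \<alpha>) Y"

primrec alpha_R :: "('l \<Rightarrow> 'c) \<Rightarrow> ('l, 'c) fre \<Rightarrow> ('l, 'c) fre" where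
  "alpha_R p Empty = Empty"
| "alpha_R p Eps = Eps"
| "alpha_R p (Letter x) = Letter x"
| "alpha_R p (Scal l a) = Conc (Letter (p l)) (alpha_R p a)"
| "alpha_R p (Plus a b) = Plus (alpha_R p a) (alpha_R p b)"
| "alpha_R p (Conc a b) = Conc (alpha_R p a) (alpha_R p b)"
| "alpha_R p (Star a) = Star (alpha_R p a)"

lemma scalars_alpha_R: "scalars (alpha_R p \<alpha>) = {}"
  by (induction \<alpha>) auto

lemma letters_alpha_R: "letters (alpha_R p \<alpha>) = letters \<alpha> \<union> p ` scalars \<alpha>"
  by (induction \<alpha>) auto

definition phi_letter :: "('l::integral_l_monoid, 'c) fre \<Rightarrow> ('l \<Rightarrow> 'c) \<Rightarrow> 'c \<Rightarrow> 'l" where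
  "phi_letter \<alpha> p z = (if z \<in> p ` scalars \<alpha> then inv_into (scalars \<alpha>) p z else 1)"

definition phi_star :: "('l::integral_l_monoid, 'c) fre \<Rightarrow> ('l \<Rightarrow> 'c) \<Rightarrow> 'c list \<Rightarrow> 'l" where
  "phi_star \<alpha> p v = prod_list (map (phi_letter \<alpha> p) v)"

text \<open>Words over \<open>X \<union> Y\<close> that become \<open>u\<close> after deletion of the letters from \<open>Y\<close>.\<close>

definition U_words :: "'c set \<Rightarrow> 'c set \<Rightarrow> 'c list \<Rightarrow> 'c list set" where
  "U_words X Y u = {v \<in> lists (X \<union> Y). filter (\<lambda>z. z \<notin> Y) v = u}"


section \<open>Fuzzy automata\<close>

text \<open>Transition and final-state maps are total on the types; only their values on \<open>states\<close> and
  \<open>alphabet\<close> matter.\<close>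

record ('q, 'c, 'l) fuzzy_automaton =
  states :: "'q set"
  alphabet :: "'c set"
  trans :: "'q \<Rightarrow> 'c \<Rightarrow> 'q \<Rightarrow> 'l"
  init :: 'q
  final :: "'q \<Rightarrow> 'l"

definition fuzzy_automaton :: "('q, 'c, 'l::integral_l_monoid) fuzzy_automaton \<Rightarrow> bool" where
  "fuzzy_automaton M \<longleftrightarrow> finite (states M) \<and> finite (alphabet M) \<and> init M \<in> states M"

definition nondeterministic_automaton :: "('q, 'c, 'l::integral_l_monoid) fuzzy_automaton \<Rightarrow> bool" where
  "nondeterministic_automaton M \<longleftrightarrow> fuzzy_automaton M \<and>
     (\<forall>a\<in>states M. \<forall>z\<in>alphabet M. \<forall>b\<in>states M. trans M a z b \<in> {bot, 1}) \<and>
     (\<forall>a\<in>states M. final M a \<in> {bot, 1})"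

text \<open>The extension of \<open>trans\<close> to words recurses on the last letter, hence the detour through the
  reversed word; \<open>trans_word_snoc\<close> is the intended recursion equation.\<close>

primrec trans_rev :: "('q, 'c, 'l::integral_l_monoid) fuzzy_automaton \<Rightarrow> 'q \<Rightarrow> 'c list \<Rightarrow> 'q \<Rightarrow> 'l" where
  "trans_rev M a [] = (\<lambda>b. if a = b then 1 else bot)"
| "trans_rev M a (x # r) = (\<lambda>b. Sup_fin ((\<lambda>c. trans_rev M a r c * trans M c x b) ` states M))"

definition trans_word :: "('q, 'c, 'l::integral_l_monoid) fuzzy_automaton \<Rightarrow> 'q \<Rightarrow> 'c list \<Rightarrow> 'q \<Rightarrow> 'l" where
  "trans_word M a u b = trans_rev M a (rev u) b"

lemma trans_word_Nil: "trans_word M a [] b = (if a = b then 1 else bot)"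
  by (simp add: trans_word_def)

lemma trans_word_snoc:
  "trans_word M a (u @ [x]) b = Sup_fin ((\<lambda>c. trans_word M a u c * trans M c x b) ` states M)"
  by (simp add: trans_word_def)

definition recognized :: "('q, 'c, 'l::integral_l_monoid) fuzzy_automaton \<Rightarrow> ('c, 'l) fuzzy_language" where
  "recognized M u = Sup_fin ((\<lambda>b. trans_word M (init M) u b * final M b) ` states M)"

definition recognizes ::
  "('q, 'c, 'l::integral_l_monoid) fuzzy_automaton \<Rightarrow> ('c, 'l) fuzzy_language \<Rightarrow> bool" where
  "recognizes M f \<longleftrightarrow> (\<forall>u \<in> lists (alphabet M). recognized M u = f u)"


section \<open>The automaton obtained from an automaton for \<open>\<alpha>\<^sub>R\<close>\<close>

definition delta_family ::
  "('l::integral_l_monoid, 'c) fre \<Rightarrow> 'c set \<Rightarrow> 'c set \<Rightarrow> ('l \<Rightarrow> 'c) \<Rightarrow>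
     ('q, 'c, 'l) fuzzy_automaton \<Rightarrow> 'q \<Rightarrow> 'c \<Rightarrow> 'q \<Rightarrow> 'l set" where
  "delta_family \<alpha> X Y p M a x b =
     (\<lambda>v. phi_star \<alpha> p v * trans_word M a v b) ` U_words X Y [x]"

definition tau_family ::
  "('l::integral_l_monoid, 'c) fre \<Rightarrow> 'c set \<Rightarrow> ('l \<Rightarrow> 'c) \<Rightarrow>
     ('q, 'c, 'l) fuzzy_automaton \<Rightarrow> 'q \<Rightarrow> 'l set" where
  "tau_family \<alpha> Y p M a =
     (\<lambda>v. Sup_fin ((\<lambda>b. phi_star \<alpha> p v * trans_word M a v b * final M b) ` states M)) ` lists Y"

definition automaton_alpha ::
  "('l::integral_l_monoid, 'c) fre \<Rightarrow> 'c set \<Rightarrow> 'c set \<Rightarrow> ('l \<Rightarrow> 'c) \<Rightarrow>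
     ('q, 'c, 'l) fuzzy_automaton \<Rightarrow> ('q, 'c, 'l) fuzzy_automaton" where
  "automaton_alpha \<alpha> X Y p M =
     \<lparr>states = states M,
      alphabet = X,
      trans = (\<lambda>a x b. lub (delta_family \<alpha> X Y p M a x b)),
      init = init M,
      final = (\<lambda>a. lub (tau_family \<alpha> Y p M a))\<rparr>"

end

theory Submission
  imports Defs "HOL-Library.Sublist"
begin

text \<open>Both \<open>\<parallel>\<alpha>\<parallel>(u)\<close> and the value at \<open>u\<close> of the constructed automaton are the supremum of the weights
  of the words of \<open>\<alpha>\<^sub>R\<close> that become \<open>u\<close> after deletion of \<open>Y\<close>. As \<open>L\<close> need not be complete and
  multiplication need not preserve infinite suprema, every supremum must already be the supremum of a
  finite subset; such suprema are compatible with unions and products. For the star this holds by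
  integrality. For paths labelled by words over \<open>Y\<close> it holds by pumping: cutting out cycles can
  only increase the weight, and only finitely many short words remain.\<close>


section \<open>Suprema attained on finite subsets\<close>

text \<open>Since \<open>F\<close> lies in \<open>S\<close>, the upper-bound half holds for
  \<open>F\<close> too, so \<open>s\<close> is the supremum of both. An empty \<open>F\<close> is
  allowed and makes \<open>s\<close> least, a case outside the reach of
  \<open>Sup_fin\<close>.\<close>

definition fin_lub :: "'l::order set \<Rightarrow> 'l \<Rightarrow> bool" where
  "fin_lub S s \<longleftrightarrow> (\<forall>x\<in>S. x \<le> s) \<and> (\<exists>F\<subseteq>S. finite F \<and> (\<forall>t. (\<forall>x\<in>F. x \<le> t) \<longrightarrow> s \<le> t))"

lemma fin_lubI:
  assumes "\<And>x. x \<in> S \<Longrightarrow> x \<le> s" "finite F" "F \<subseteq> S" "\<And>t. (\<And>x. x \<in> F \<Longrightarrow> x \<le> t) \<Longrightarrow> s \<le> t"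
  shows "fin_lub S s"
  unfolding fin_lub_def
proof (intro conjI exI[of _ F] ballI allI impI)
  fix t assume "\<forall>x\<in>F. x \<le> t"
  then show "s \<le> t" by (intro assms(4)) simp
qed (use assms(1-3) in simp_all)

lemma fin_lubE:
  assumes "fin_lub S s"
  obtains F where "\<forall>x\<in>S. x \<le> s" "finite F" "F \<subseteq> S" "\<forall>t. (\<forall>x\<in>F. x \<le> t) \<longrightarrow> s \<le> t"
  using assms unfolding fin_lub_def by blast

lemma fin_lub_isLub: "fin_lub S s \<Longrightarrow> isLub UNIV S s"
  unfolding fin_lub_def isLub_UNIV_iff by blast

lemma fin_lub_unique: "fin_lub S s \<Longrightarrow> fin_lub S t \<Longrightarrow> s = t"
  using lub_eqI[OF fin_lub_isLub, of S s] lub_eqI[OF fin_lub_isLub, of S t] by simp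

lemma fin_lub_empty: "fin_lub {} (bot :: 'l::order_bot)"
  by (rule fin_lubI[of _ _ "{}"]) auto

lemma fin_lub_singleton: "fin_lub {x} x"
  by (rule fin_lubI[of _ _ "{x}"]) auto

text \<open>The families in the construction range over all words and take the value
  \<open>bot\<close> on words without a suitable path. This discards those values and leaves the
  weights of the remaining words.\<close>

lemma fin_lub_insert_bot:
  fixes s :: "'l::order_bot"
  assumes "fin_lub S s" "S \<subseteq> T" "T \<subseteq> insert bot S"
  shows "fin_lub T s"
  using assms(1)
proof (rule fin_lubE)
  fix F assume F: "\<forall>x\<in>S. x \<le> s" "finite F" "F \<subseteq> S" "\<forall>t. (\<forall>x\<in>F. x \<le> t) \<longrightarrow> s \<le> t"
  show ?thesis
  proof (rule fin_lubI[of _ _ F])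
    show "x \<le> s" if "x \<in> T" for x using that F(1) assms(3) by auto
    show "F \<subseteq> T" using F(3) assms(2) by (rule subset_trans)
  qed (use F(2,4) in simp_all)
qed

text \<open>Finitely many indices \<open>J\<close> already determine \<open>t\<close>, and each
  \<open>S i\<close> with \<open>i\<close> in \<open>J\<close> has a finite witness, so the union of
  these witnesses is finite. The index set may be infinite, as it is for the star.\<close>

lemma fin_lub_UN:
  assumes S: "\<And>i. i \<in> I \<Longrightarrow> fin_lub (S i) (s i)" and t: "fin_lub (s ` I) t"
  shows "fin_lub (\<Union>i\<in>I. S i) t"
  using t
proof (rule fin_lubE)
  fix F assume F: "\<forall>x\<in>s ` I. x \<le> t" "finite F" "F \<subseteq> s ` I"
    "\<forall>r. (\<forall>x\<in>F. x \<le> r) \<longrightarrow> t \<le> r"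
  from finite_subset_image[OF F(2,3)] obtain J where J: "J \<subseteq> I" "finite J" "F = s ` J" by blast
  have "\<forall>i\<in>J. \<exists>G. finite G \<and> G \<subseteq> S i \<and> (\<forall>r. (\<forall>x\<in>G. x \<le> r) \<longrightarrow> s i \<le> r)"
  proof
    fix i assume "i \<in> J"
    then have "fin_lub (S i) (s i)" using S J(1) by blast
    then show "\<exists>G. finite G \<and> G \<subseteq> S i \<and> (\<forall>r. (\<forall>x\<in>G. x \<le> r) \<longrightarrow> s i \<le> r)"
      by (rule fin_lubE) (intro exI conjI)
  qed
  then obtain G where
    "\<forall>i\<in>J. finite (G i) \<and> G i \<subseteq> S i \<and> (\<forall>r. (\<forall>x\<in>G i. x \<le> r) \<longrightarrow> s i \<le> r)"
    by (rule bchoice[THEN exE])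
  then have G: "\<forall>i\<in>J. finite (G i)" "\<forall>i\<in>J. G i \<subseteq> S i"
    "\<forall>i\<in>J. \<forall>r. (\<forall>x\<in>G i. x \<le> r) \<longrightarrow> s i \<le> r" by simp_all
  show ?thesis
  proof (rule fin_lubI[of _ _ "\<Union>i\<in>J. G i"])
    fix x assume "x \<in> (\<Union>i\<in>I. S i)"
    then obtain i where i: "i \<in> I" "x \<in> S i" by blast
    then have "x \<le> s i" using S[of i] by (auto simp: fin_lub_def)
    also have "s i \<le> t" using F(1) i(1) by simp
    finally show "x \<le> t" .
  next
    fix r assume r: "\<And>x. x \<in> (\<Union>i\<in>J. G i) \<Longrightarrow> x \<le> r"
    have "s i \<le> r" if "i \<in> J" for i
      by (rule G(3)[rule_format, OF that]) (use r that in blast)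
    then show "t \<le> r" using F(4) J(3) by simp
  next
    show "finite (\<Union>i\<in>J. G i)" using G(1) J(2) by simp
    show "(\<Union>i\<in>J. G i) \<subseteq> (\<Union>i\<in>I. S i)" using G(2) J(1) by (intro UN_mono) simp_all
  qed
qed

lemma fin_lub_Sup_fin:
  "finite A \<Longrightarrow> A \<noteq> {} \<Longrightarrow> fin_lub A (Sup_fin A :: 'l::lattice)"
  by (rule fin_lubI[of _ _ A]) (auto intro: Sup_fin.coboundedI Sup_fin.boundedI)

lemma fin_lub_finite: "finite A \<Longrightarrow> \<exists>s :: 'l::bounded_lattice. fin_lub A s"
  by (cases "A = {}") (auto intro: fin_lub_empty fin_lub_Sup_fin)

lemma fin_lub_UN_finite:
  fixes S :: "'i \<Rightarrow> 'l::bounded_lattice set"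
  assumes "finite I" "\<And>i. i \<in> I \<Longrightarrow> \<exists>s. fin_lub (S i) s"
  shows "\<exists>s. fin_lub (\<Union>i\<in>I. S i) s"
proof -
  from assms(2) have "\<forall>i\<in>I. \<exists>s. fin_lub (S i) s" by blast
  then obtain s where "\<forall>i\<in>I. fin_lub (S i) (s i)" by (rule bchoice[THEN exE])
  moreover obtain t where "fin_lub (s ` I) t" using fin_lub_finite assms(1) by blast
  ultimately show ?thesis using fin_lub_UN[of I S s t] by blast
qed

text \<open>A finite cofinal subset has the same upper bounds as the whole set. This is the form in
  which pumping yields existence.\<close>

lemma fin_lub_dominated:
  fixes S :: "'l::bounded_lattice set"
  assumes "finite F" "F \<subseteq> S" "\<And>x. x \<in> S \<Longrightarrow> \<exists>y\<in>F. x \<le> y"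
  shows "\<exists>s. fin_lub S s"
proof -
  obtain s where "fin_lub F s" using fin_lub_finite assms(1) by blast
  then have s: "\<forall>x\<in>F. x \<le> s" "\<forall>t. (\<forall>x\<in>F. x \<le> t) \<longrightarrow> s \<le> t"
    by (auto dest: fin_lub_isLub simp: isLub_UNIV_iff)
  have "fin_lub S s"
  proof (rule fin_lubI[of _ _ F])
    fix x assume "x \<in> S"
    then obtain y where "y \<in> F" "x \<le> y" using assms(3) by blast
    then show "x \<le> s" using s(1) by (auto intro: order_trans)
  qed (use s(2) assms(1,2) in simp_all)
  then show ?thesis ..
qed

text \<open>For crisp values, joins over the states turn into existential quantifiers over the
  states.\<close>

lemma Sup_fin_indicator:
  assumes "finite A" "a \<in> A"
  shows "Sup_fin ((\<lambda>c. if P c then k else bot) ` A) = (if \<exists>c\<in>A. P c then k else bot :: 'l::bounded_lattice)"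
proof (rule fin_lub_unique)
  let ?S = "(\<lambda>c. if P c then k else bot :: 'l) ` A"
  show "fin_lub ?S (Sup_fin ?S)" using assms by (intro fin_lub_Sup_fin) auto
  show "fin_lub ?S (if \<exists>c\<in>A. P c then k else bot)"
    by (rule fin_lub_insert_bot[of "if \<exists>c\<in>A. P c then {k} else {}"])
      (auto simp: fin_lub_singleton fin_lub_empty)
qed

section \<open>Products of finitely attained suprema\<close>

lemma mult_Sup_fin_right:
  fixes A :: "'l::integral_l_monoid set"
  assumes "finite A" "A \<noteq> {}"
  shows "z * Sup_fin A = Sup_fin ((\<lambda>x. z * x) ` A)"
  using assms by (induction A rule: finite_ne_induct) (auto simp: mult_sup_distrib)

text \<open>Only finite joins distribute over multiplication, so \<open>s\<close> is first bounded
  by the join of \<open>F\<close>. Inserting \<open>bot\<close> covers an empty \<open>F\<close> and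
  is harmless because \<open>bot\<close> is absorbing.\<close>

lemma finite_lub_mult_le:
  fixes s :: "'l::integral_l_monoid"
  assumes "finite F" "\<forall>t. (\<forall>x\<in>F. x \<le> t) \<longrightarrow> s \<le> t"
    and "\<And>x. x \<in> F \<Longrightarrow> x * y \<le> r"
  shows "s * y \<le> r"
proof -
  have "s \<le> Sup_fin (insert bot F)"
    using assms(1) by (intro assms(2)[rule_format] Sup_fin.coboundedI) auto
  then have "s * y \<le> Sup_fin (insert bot F) * y" by (rule mult_left_mono_l)
  also have "\<dots> = Sup_fin ((\<lambda>x. x * y) ` insert bot F)" using assms(1) by (intro mult_Sup_fin) auto
  also have "\<dots> \<le> r"
    by (rule Sup_fin.boundedI) (use assms(1,3) in \<open>auto simp: mult_bot_left\<close>)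
  finally show ?thesis .
qed

lemma finite_lub_mult_le_right:
  fixes s :: "'l::integral_l_monoid"
  assumes "finite F" "\<forall>t. (\<forall>x\<in>F. x \<le> t) \<longrightarrow> s \<le> t"
    and "\<And>x. x \<in> F \<Longrightarrow> y * x \<le> r"
  shows "y * s \<le> r"
proof -
  have "s \<le> Sup_fin (insert bot F)"
    using assms(1) by (intro assms(2)[rule_format] Sup_fin.coboundedI) auto
  then have "y * s \<le> y * Sup_fin (insert bot F)" by (rule mult_right_mono_l)
  also have "\<dots> = Sup_fin ((\<lambda>x. y * x) ` insert bot F)"
    using assms(1) by (intro mult_Sup_fin_right) auto
  also have "\<dots> \<le> r"
    by (rule Sup_fin.boundedI) (use assms(1,3) in \<open>auto simp: mult_bot_right\<close>)
  finally show ?thesis .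
qed

text \<open>Monotonicity gives the upper bound. For leastness the products of the two finite
  witnesses suffice: one factor is passed to its supremum at a time, first the right one for fixed
  \<open>x\<close>, then the left one.\<close>

lemma fin_lub_mult:
  fixes s t :: "'l::integral_l_monoid"
  assumes "fin_lub S s" "fin_lub T t"
  shows "fin_lub {x * y |x y. x \<in> S \<and> y \<in> T} (s * t)"
proof -
  from assms(1) obtain F where F: "\<forall>x\<in>S. x \<le> s" "finite F" "F \<subseteq> S"
    "\<forall>r. (\<forall>x\<in>F. x \<le> r) \<longrightarrow> s \<le> r" by (rule fin_lubE)
  from assms(2) obtain G where G: "\<forall>x\<in>T. x \<le> t" "finite G" "G \<subseteq> T"
    "\<forall>r. (\<forall>x\<in>G. x \<le> r) \<longrightarrow> t \<le> r" by (rule fin_lubE)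
  show ?thesis
  proof (rule fin_lubI[of _ _ "(\<lambda>(x, y). x * y) ` (F \<times> G)"])
    fix z assume "z \<in> {x * y |x y. x \<in> S \<and> y \<in> T}"
    then obtain x y where z: "z = x * y" "x \<in> S" "y \<in> T" by blast
    have "x * y \<le> s * y" using F(1) z(2) by (intro mult_left_mono_l) simp
    also have "\<dots> \<le> s * t" using G(1) z(3) by (intro mult_right_mono_l) simp
    finally show "z \<le> s * t" using z(1) by simp
  next
    fix r assume r: "\<And>z. z \<in> (\<lambda>(x, y). x * y) ` (F \<times> G) \<Longrightarrow> z \<le> r"
    have "x * t \<le> r" if "x \<in> F" for x
      by (rule finite_lub_mult_le_right[OF G(2,4)]) (use r that in auto)
    then show "s * t \<le> r" by (rule finite_lub_mult_le[OF F(2,4)])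
  next
    show "(\<lambda>(x, y). x * y) ` (F \<times> G) \<subseteq> {x * y |x y. x \<in> S \<and> y \<in> T}"
      using F(3) G(3) by auto
  qed (use F(2) G(2) in simp)
qed


section \<open>The fuzzy language as a weighted crisp language\<close>

primrec lang_pow :: "'c list set \<Rightarrow> nat \<Rightarrow> 'c list set" where
  "lang_pow A 0 = {[]}"
| "lang_pow A (Suc n) = {v @ w |v w. v \<in> lang_pow A n \<and> w \<in> A}"

text \<open>The crisp language of \<open>alpha_R p \<alpha>\<close>, computed on \<alpha> itself so
  that inductions can still see the scalars; \<open>lang_alpha_R\<close> identifies the two.\<close>

primrec lang :: "('l \<Rightarrow> 'c) \<Rightarrow> ('l, 'c) fre \<Rightarrow> 'c list set" where
  "lang p Empty = {}"
| "lang p Eps = {[]}"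
| "lang p (Letter x) = {[x]}"
| "lang p (Scal l a) = {p l # v |v. v \<in> lang p a}"
| "lang p (Plus a b) = lang p a \<union> lang p b"
| "lang p (Conc a b) = {v @ w |v w. v \<in> lang p a \<and> w \<in> lang p b}"
| "lang p (Star a) = (\<Union>n. lang_pow (lang p a) n)"

lemma lang_alpha_R: "lang p (alpha_R p \<alpha>) = lang p \<alpha>"
  by (induction \<alpha>) auto

lemma lang_pow_lists: "A \<subseteq> lists Z \<Longrightarrow> lang_pow A n \<subseteq> lists Z"
proof (induction n)
  case (Suc n)
  show ?case
  proof
    fix z assume "z \<in> lang_pow A (Suc n)"
    then obtain v w where "z = v @ w" "v \<in> lang_pow A n" "w \<in> A" by auto
    then have "v \<in> lists Z" "w \<in> lists Z" using Suc by blast+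
    then show "z \<in> lists Z" using \<open>z = v @ w\<close> by simp
  qed
qed simp

lemma lang_lists: "letters \<alpha> \<union> p ` scalars \<alpha> \<subseteq> Z \<Longrightarrow> lang p \<alpha> \<subseteq> lists Z"
proof (induction \<alpha>)
  case (Scal l a)
  then have "p l \<in> Z" "lang p a \<subseteq> lists Z" by auto
  then show ?case by (auto simp: subset_iff in_lists_conv_set)
next
  case (Plus a b)
  then have "lang p a \<subseteq> lists Z" "lang p b \<subseteq> lists Z" by (simp_all add: image_Un)
  then show ?case by simp
next
  case (Conc a b)
  then have "lang p a \<subseteq> lists Z" "lang p b \<subseteq> lists Z" by (simp_all add: image_Un)
  then show ?case by (auto simp: subset_iff in_lists_conv_set)
next
  case (Star a)
  then have "lang p a \<subseteq> lists Z" by auto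
  then show ?case using lang_pow_lists[of "lang p a" Z] by (simp add: UN_subset_iff)
qed simp_all

section \<open>Weights of words and the semantics as their supremum\<close>

abbreviation weight :: "('c \<Rightarrow> 'l::monoid_mult) \<Rightarrow> 'c list \<Rightarrow> 'l" where
  "weight h v \<equiv> prod_list (map h v)"

text \<open>By integrality every deleted letter contributes a factor below \<open>1\<close>, so its
  removal can only increase the product.\<close>

lemma weight_subseq: "subseq v w \<Longrightarrow> weight h w \<le> (weight h v :: 'l::integral_l_monoid)"
proof (induction rule: list_emb.induct)
  case (list_emb_Nil ys)
  then show ?case by (simp add: one_greatest)
next
  case (list_emb_Cons xs ys y)
  have "h y * weight h ys \<le> 1 * weight h ys" by (rule mult_left_mono_l[OF one_greatest])
  with list_emb_Cons show ?case by simp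
next
  case (list_emb_Cons2 x y xs ys)
  then show ?case by (simp add: mult_right_mono_l)
qed

definition weights :: "('c \<Rightarrow> 'l::monoid_mult) \<Rightarrow> 'c set \<Rightarrow> 'c list set \<Rightarrow> 'c list \<Rightarrow> 'l set" where
  "weights h Y A u = weight h ` {v \<in> A. filter (\<lambda>z. z \<notin> Y) v = u}"

text \<open>Deletion of \<open>Y\<close> commutes with concatenation and \<open>weight\<close> is
  multiplicative, so a factorization of a word induces one of \<open>u\<close> and of its
  weight.\<close>

lemma weights_conc:
  "weights h Y {v @ w |v w. v \<in> A \<and> w \<in> B} u =
    (\<Union>(v, w)\<in>{(v, w). u = v @ w}. {x * y |x y. x \<in> weights h Y A v \<and> y \<in> weights h Y B w})"
    (is "?L = ?R")
proof (intro equalityI subsetI)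
  fix z assume "z \<in> ?L"
  then obtain v w where z: "z = weight h v * weight h w" "v \<in> A" "w \<in> B"
    and u: "u = filter (\<lambda>z. z \<notin> Y) v @ filter (\<lambda>z. z \<notin> Y) w" by (auto simp: weights_def)
  from z(2,3) have "weight h v \<in> weights h Y A (filter (\<lambda>z. z \<notin> Y) v)"
    "weight h w \<in> weights h Y B (filter (\<lambda>z. z \<notin> Y) w)" by (simp_all add: weights_def)
  with z(1) u show "z \<in> ?R" by (intro UN_I[of "(_, _)"]) auto
next
  fix z assume "z \<in> ?R"
  then obtain v w where z: "z = weight h (v @ w)" "v \<in> A" "w \<in> B"
    and u: "u = filter (\<lambda>z. z \<notin> Y) (v @ w)" by (auto simp: weights_def)
  from z(2,3) have "v @ w \<in> {v @ w |v w. v \<in> A \<and> w \<in> B}" by blast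
  with z(1) u show "z \<in> ?L" unfolding weights_def by (intro image_eqI[of _ _ "v @ w"]) simp_all
qed

lemma fin_lub_fl_conc:
  assumes "\<And>u. fin_lub (weights h Y A u) (f u)" "\<And>u. fin_lub (weights h Y B u) (g u)"
  shows "fin_lub (weights h Y {v @ w |v w. v \<in> A \<and> w \<in> B} u) (fl_conc f g u)"
  unfolding weights_conc
proof (rule fin_lub_UN[where s = "\<lambda>(v, w). f v * g w"])
  have "(\<lambda>(v, w). f v * g w) ` {(v, w). u = v @ w} = {f v * g w |v w. u = v @ w}" by auto
  moreover have "fin_lub {f v * g w |v w. u = v @ w} (fl_conc f g u)"
    unfolding fl_conc_def by (intro fin_lub_Sup_fin finite_splits) auto
  ultimately show "fin_lub ((\<lambda>(v, w). f v * g w) ` {(v, w). u = v @ w}) (fl_conc f g u)" by simp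
qed (use fin_lub_mult[OF assms] in auto)

lemma fin_lub_fl_pow:
  assumes "\<And>u. fin_lub (weights h Y A u) (f u)"
  shows "fin_lub (weights h Y (lang_pow A n) u) (fl_pow f n u)"
proof (induction n arbitrary: u)
  case 0
  have "weights h Y {[]} u = (if u = [] then {1} else {})" by (auto simp: weights_def)
  then show ?case by (simp add: fin_lub_empty fin_lub_singleton)
next
  case (Suc n)
  show ?case using fin_lub_fl_conc[OF Suc assms] by simp
qed

text \<open>Sharpens \<open>fl_star_isLub\<close>: by \<open>fl_pow_le\<close> the powers up to the
  length of \<open>u\<close> form a finite witness.\<close>

lemma fin_lub_fl_star: "fin_lub (range (\<lambda>n. fl_pow f n u)) (fl_star f u)"
proof (rule fin_lubI[of _ _ "(\<lambda>n. fl_pow f n u) ` {..length u}"])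
  fix x assume "x \<in> range (\<lambda>n. fl_pow f n u)"
  then show "x \<le> fl_star f u" using fl_star_isLub[of f u] by (auto simp: isLub_UNIV_iff)
next
  fix t assume t: "\<And>x. x \<in> (\<lambda>n. fl_pow f n u) ` {..length u} \<Longrightarrow> x \<le> t"
  have "Sup_fin ((\<lambda>k. fl_pow f k u) ` {..length u}) \<le> t" by (rule Sup_fin.boundedI) (use t in auto)
  then have "\<forall>n. fl_pow f n u \<le> t" using fl_pow_le order_trans by blast
  then show "fl_star f u \<le> t" using fl_star_isLub[of f u] by (auto simp: isLub_UNIV_iff)
qed auto

text \<open>Each operation on expressions is a union or a product of languages, and
  \<open>fin_lub\<close> respects both. The weight \<open>h\<close> stays general because the result
  is used twice: with \<open>phi_letter\<close> for \<alpha>, and with constant weight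
  \<open>1\<close> and empty \<open>Y\<close> for \<open>alpha_R\<close>.\<close>

lemma fin_lub_sem:
  assumes "letters \<alpha> \<subseteq> X" "p ` scalars \<alpha> \<subseteq> Y" "Y \<inter> X = {}"
    and "\<And>x. x \<in> X \<Longrightarrow> h x = 1" "\<And>l. l \<in> scalars \<alpha> \<Longrightarrow> h (p l) = l"
  shows "fin_lub (weights h Y (lang p \<alpha>) u) (sem \<alpha> u)"
  using assms(1,2,5)
proof (induction \<alpha> arbitrary: u)
  case Empty
  then show ?case by (simp add: weights_def fin_lub_empty)
next
  case Eps
  have "weights h Y {[]} u = (if u = [] then {1} else {})" by (auto simp: weights_def)
  then show ?case by (simp add: fin_lub_empty fin_lub_singleton)
next
  case (Letter x)
  then have "x \<notin> Y" "h x = 1" using assms(3,4) by auto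
  then have "weights h Y {[x]} u = (if u = [x] then {1} else {})" by (auto simp: weights_def)
  then show ?case by (simp add: fin_lub_empty fin_lub_singleton)
next
  case (Scal l a)
  then have "p l \<in> Y" "h (p l) = l" by auto
  \<comment> \<open>The letter \<open>p l\<close> lies in \<open>Y\<close>, so its deletion leaves
    \<open>u\<close> unchanged, while it contributes the left factor \<open>l\<close>.\<close>
  then have "weights h Y (lang p (Scal l a)) u = {x * y |x y. x \<in> {l} \<and> y \<in> weights h Y (lang p a) u}"
    by (force simp: weights_def image_iff)
  then show ?case using fin_lub_mult[OF fin_lub_singleton Scal.IH, of l u] Scal.prems by simp
next
  case (Plus a b)
  \<comment> \<open>Indexing by booleans presents the binary union as an indexed one, as
    \<open>fin_lub_UN\<close> requires.\<close>
  let ?s = "\<lambda>i. if i then sem a u else sem b u"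
    and ?S = "\<lambda>i. if i then weights h Y (lang p a) u else weights h Y (lang p b) u"
  have "fin_lub (\<Union>i\<in>UNIV. ?S i) (Sup_fin (range ?s))"
    by (rule fin_lub_UN[of _ _ ?s]) (use Plus in \<open>auto simp: image_Un intro!: fin_lub_Sup_fin\<close>)
  moreover have "(\<Union>i\<in>UNIV. ?S i) = weights h Y (lang p (Plus a b)) u"
    by (auto simp: weights_def UNIV_bool)
  moreover have "Sup_fin (range ?s) = sem (Plus a b) u" by (simp add: UNIV_bool sup_commute)
  ultimately show ?case by metis
next
  case (Conc a b)
  then have "fin_lub (weights h Y (lang p a) u) (sem a u)" "fin_lub (weights h Y (lang p b) u) (sem b u)"
    for u by (auto simp: image_Un)
  then show ?case unfolding lang.simps sem.simps by (rule fin_lub_fl_conc)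
next
  case (Star a)
  have "fin_lub (\<Union>n\<in>UNIV. weights h Y (lang_pow (lang p a) n) u) (fl_star (sem a) u)"
    by (rule fin_lub_UN[OF fin_lub_fl_pow fin_lub_fl_star]) (use Star in simp)
  moreover have "(\<Union>n\<in>UNIV. weights h Y (lang_pow (lang p a) n) u) = weights h Y (lang p (Star a)) u"
    by (auto simp: weights_def)
  ultimately show ?case by simp
qed

text \<open>With nothing deleted and all letters weighing \<open>1\<close>, the weight set at
  \<open>u\<close> is \<open>{1}\<close> or empty according to membership of
  \<open>u\<close>.\<close>

lemma sem_alpha_R: "sem (alpha_R p \<alpha>) u = (if u \<in> lang p \<alpha> then 1 else bot)"
proof -
  have "fin_lub (weights (\<lambda>_. 1) {} (lang p (alpha_R p \<alpha>)) u) (sem (alpha_R p \<alpha>) u)"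
    by (rule fin_lub_sem[where X = UNIV]) (auto simp: scalars_alpha_R)
  moreover have "weights (\<lambda>_. 1) {} (lang p \<alpha>) u = (if u \<in> lang p \<alpha> then {1 :: 'a} else {})"
    by (auto simp: weights_def map_replicate_const prod_list_replicate)
  ultimately have "fin_lub (if u \<in> lang p \<alpha> then {1} else {}) (sem (alpha_R p \<alpha>) u)"
    by (simp add: lang_alpha_R)
  then show ?thesis
    by (rule fin_lub_unique) (simp add: fin_lub_singleton fin_lub_empty)
qed


section \<open>Paths of a nondeterministic automaton\<close>

text \<open>Recursion on the first letter suits cutting and pumping, whereas
  \<open>trans_word\<close> recurses on the last one; \<open>path_append\<close> mediates between
  them.\<close>

primrec path :: "('q, 'c, 'l::integral_l_monoid) fuzzy_automaton \<Rightarrow> 'q \<Rightarrow> 'c list \<Rightarrow> 'q \<Rightarrow> bool" where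
  "path M a [] b \<longleftrightarrow> a = b"
| "path M a (z # v) b \<longleftrightarrow> (\<exists>c\<in>states M. trans M a z c = 1 \<and> path M c v b)"

lemma path_append:
  "a \<in> states M \<Longrightarrow> path M a (v @ w) b \<longleftrightarrow> (\<exists>c\<in>states M. path M a v c \<and> path M c w b)"
  by (induction v arbitrary: a) auto

text \<open>Pumping: two equal states among the positions \<open>0, \<dots>, length v\<close> of a run allow a cycle to be cut out.\<close>

lemma path_short:
  assumes "finite (states M)" "a \<in> states M" "path M a v b"
  shows "\<exists>v'. subseq v' v \<and> length v' < card (states M) \<and> path M a v' b"
  using assms(3)
proof (induction "length v" arbitrary: v rule: less_induct)
  case less
  show ?case
  proof (cases "length v < card (states M)")
    case True
    then show ?thesis using less.prems by blast
  next
    case False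
    have "\<exists>q\<in>states M. path M a (take i v) q \<and> path M q (drop i v) b" for i
      using less.prems path_append[OF assms(2), of "take i v" "drop i v" b] by simp
    then obtain q where q: "\<And>i. q i \<in> states M" "\<And>i. path M a (take i v) (q i)"
      "\<And>i. path M (q i) (drop i v) b" by metis
    \<comment> \<open>There is one more position than letters, so
      \<open>length v = card (states M)\<close> already forces a repetition.\<close>
    have "\<not> inj_on q {..length v}"
    proof (rule pigeonhole)
      have "card (q ` {..length v}) \<le> card (states M)"
        by (rule card_mono) (use assms(1) q(1) in auto)
      then show "card (q ` {..length v}) < card {..length v}" using False by simp
    qed
    then obtain i j where ij: "i < j" "j \<le> length v" "q i = q j"
      unfolding inj_on_def by (metis atMost_iff linorder_neqE_nat)
    let ?w = "take i v @ drop j v"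
    have "path M a ?w b" using path_append[OF assms(2)] q ij(3) by metis
    moreover have "length ?w < length v" using ij by simp
    moreover have "subseq ?w v"
    proof -
      have "subseq (drop j v) (drop i v)"
        using ij(1) by (metis drop_drop le_add_diff_inverse2 less_imp_le suffix_drop suffix_imp_subseq)
      then show ?thesis by (metis append_take_drop_id subseq_append_iff subseq_order.order_refl list_emb_append_mono)
    qed
    ultimately show ?thesis using less.hyps subseq_order.order_trans by blast
  qed
qed

lemma trans_word_path:
  assumes "nondeterministic_automaton M" "v \<in> lists (alphabet M)" "a \<in> states M" "b \<in> states M"
  shows "trans_word M a v b = (if path M a v b then 1 else bot)"
  using assms(2,4)
proof (induction v arbitrary: b rule: rev_induct)
  case Nil
  then show ?case by (simp add: trans_word_Nil)
next
  case (snoc z v)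
  have fin: "finite (states M)" using assms(1)
    by (simp add: nondeterministic_automaton_def fuzzy_automaton_def)
  let ?A = "(\<lambda>c. trans_word M a v c * trans M c z b) ` states M"
  have vals: "trans_word M a v c * trans M c z b = (if path M a v c \<and> trans M c z b = 1 then 1 else bot)"
    if "c \<in> states M" for c
  proof -
    have "trans M c z b \<in> {bot, 1}"
      using assms(1) that snoc.prems by (auto simp: nondeterministic_automaton_def)
    then show ?thesis using snoc.IH[of c] snoc.prems(1) that by (auto simp: mult_bot_left)
  qed
  have p: "path M a (v @ [z]) b \<longleftrightarrow> (\<exists>c\<in>states M. path M a v c \<and> trans M c z b = 1)"
    using path_append[OF assms(3)] snoc.prems(2) by auto
  have "?A = (\<lambda>c. if path M a v c \<and> trans M c z b = 1 then 1 else bot) ` states M"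
    using vals by (rule image_cong[OF refl])
  also have "Sup_fin \<dots> = (if path M a (v @ [z]) b then 1 else bot)"
    unfolding p using fin assms(3) by (rule Sup_fin_indicator)
  finally show ?case by (simp add: trans_word_snoc)
qed

definition accepts :: "('q, 'c, 'l::integral_l_monoid) fuzzy_automaton \<Rightarrow> 'q \<Rightarrow> 'c list \<Rightarrow> bool" where
  "accepts M a v \<longleftrightarrow> (\<exists>b\<in>states M. path M a v b \<and> final M b = 1)"

lemma accepts_append:
  "a \<in> states M \<Longrightarrow> accepts M a (v @ w) \<longleftrightarrow> (\<exists>c\<in>states M. path M a v c \<and> accepts M c w)"
  unfolding accepts_def by (auto simp: path_append)

text \<open>The factor \<open>k\<close> is the weight of \<open>v\<close> when the final values of
  the new automaton are computed, and \<open>1\<close> when acceptance by \<open>M\<close>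
  is.\<close>

lemma Sup_fin_accepts:
  assumes "nondeterministic_automaton M" "v \<in> lists (alphabet M)" "a \<in> states M"
  shows "Sup_fin ((\<lambda>b. k * trans_word M a v b * final M b) ` states M) = (if accepts M a v then k else bot)"
proof -
  have "k * trans_word M a v b * final M b = (if path M a v b \<and> final M b = 1 then k else bot)"
    if "b \<in> states M" for b
  proof -
    have "final M b \<in> {bot, 1}" using assms(1) that by (auto simp: nondeterministic_automaton_def)
    then show ?thesis
      using trans_word_path[OF assms that] by (auto simp: mult_bot_right mult_bot_left)
  qed
  then have "(\<lambda>b. k * trans_word M a v b * final M b) ` states M =
      (\<lambda>b. if path M a v b \<and> final M b = 1 then k else bot) ` states M"
    by (rule image_cong[OF refl])
  also have "Sup_fin \<dots> = (if accepts M a v then k else bot)"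
    unfolding accepts_def
    by (rule Sup_fin_indicator[OF _ assms(3)])
      (use assms(1) in \<open>simp add: nondeterministic_automaton_def fuzzy_automaton_def\<close>)
  finally show ?thesis .
qed

lemma recognized_accepts:
  assumes "nondeterministic_automaton M" "v \<in> lists (alphabet M)"
  shows "recognized M v = (if accepts M (init M) v then 1 else bot)"
  using Sup_fin_accepts[OF assms, of "init M" 1] assms(1)
  by (simp add: recognized_def nondeterministic_automaton_def fuzzy_automaton_def)


section \<open>Transitions along words with inserted weight letters\<close>

text \<open>The cut is not unique, since letters failing \<open>P\<close> around it may go to either
  side; the induction cuts as late as possible.\<close>

lemma filter_eq_appendE:
  assumes "filter P v = a @ b"
  obtains v1 v2 where "v = v1 @ v2" "filter P v1 = a" "filter P v2 = b"
  using assms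
proof (induction v arbitrary: a thesis)
  case Nil
  then show ?case by simp
next
  case (Cons x v)
  show ?case
  proof (cases "P x \<and> a \<noteq> []")
    case True
    then obtain a' where a: "a = x # a'" "filter P v = a' @ b"
      using Cons.prems(2) by (cases a) auto
    from Cons.IH[OF _ a(2)] obtain v1 v2 where "v = v1 @ v2" "filter P v1 = a'" "filter P v2 = b"
      by blast
    then show ?thesis using Cons.prems(1)[of "x # v1" v2] True a by simp
  next
    case False
    show ?thesis
    proof (cases "P x")
      case True
      then show ?thesis using Cons.prems(1)[of "[]" "x # v"] Cons.prems(2) False by simp
    next
      case False
      then have "filter P v = a @ b" using Cons.prems(2) by simp
      from Cons.IH[OF _ this] obtain v1 v2 where "v = v1 @ v2" "filter P v1 = a" "filter P v2 = b"
        by blast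
      then show ?thesis using Cons.prems(1)[of "x # v1" v2] False by simp
    qed
  qed
qed

lemma U_words_Nil: "U_words X Y [] = lists Y"
  by (auto simp: U_words_def filter_empty_conv)

lemma U_words_append: "v \<in> U_words X Y u \<Longrightarrow> w \<in> U_words X Y u' \<Longrightarrow> v @ w \<in> U_words X Y (u @ u')"
  by (auto simp: U_words_def)

lemma U_words_lists: "v \<in> U_words X Y u \<Longrightarrow> v \<in> lists (X \<union> Y)"
  by (simp add: U_words_def)

lemma U_words_singleton:
  assumes "x \<in> X" "Y \<inter> X = {}"
  shows "U_words X Y [x] = {v @ x # w |v w. v \<in> lists Y \<and> w \<in> lists Y}"
proof (intro equalityI subsetI)
  fix z assume "z \<in> U_words X Y [x]"
  then have "filter (\<lambda>z. z \<notin> Y) z = [x]" by (simp add: U_words_def)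
  then obtain v w where "z = v @ x # w" "\<forall>y\<in>set v. y \<in> Y" "filter (\<lambda>z. z \<notin> Y) w = []"
    by (auto simp: filter_eq_Cons_iff)
  then show "z \<in> {v @ x # w |v w. v \<in> lists Y \<and> w \<in> lists Y}"
    by (auto simp: filter_empty_conv in_lists_conv_set)
next
  fix z assume "z \<in> {v @ x # w |v w. v \<in> lists Y \<and> w \<in> lists Y}"
  then show "z \<in> U_words X Y [x]"
    using assms by (auto simp: U_words_def filter_empty_conv)
qed

text \<open>A word \<open>u\<close> read by the automaton for \<open>\<alpha>\<close> absorbs inserted letters only through its own
  letters: all of \<open>U_words X Y u\<close> if \<open>u\<close> is nonempty, but only the empty word if \<open>u\<close> is empty.\<close>

definition run_words :: "'c set \<Rightarrow> 'c set \<Rightarrow> 'c list \<Rightarrow> 'c list set" where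
  "run_words X Y u = {v \<in> U_words X Y u. u = [] \<longrightarrow> v = []}"

text \<open>Inserted letters between \<open>u\<close> and \<open>u'\<close> may go to either part.
  If \<open>u\<close> is empty they must all go to \<open>v2\<close>, because no transition has yet
  been made that could absorb them.\<close>

lemma U_words_split:
  assumes "v \<in> U_words X Y (u @ u')"
  obtains v1 v2 where "v = v1 @ v2" "v1 \<in> run_words X Y u" "v2 \<in> U_words X Y u'"
proof (cases "u = []")
  case True
  then show ?thesis using that[of "[]" v] assms by (simp add: run_words_def U_words_def)
next
  case False
  from assms have "filter (\<lambda>z. z \<notin> Y) v = u @ u'" by (simp add: U_words_def)
  then obtain v1 v2 where "v = v1 @ v2" "filter (\<lambda>z. z \<notin> Y) v1 = u" "filter (\<lambda>z. z \<notin> Y) v2 = u'"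
    by (rule filter_eq_appendE)
  then show ?thesis using that[of v1 v2] assms False by (auto simp: run_words_def U_words_def)
qed

text \<open>Reduces identities between sets of weights to identities between sets of words.\<close>

lemma image_weight_append:
  "{x * y |x y. x \<in> weight h ` A \<and> y \<in> weight h ` B} = weight h ` {v @ w |v w. v \<in> A \<and> w \<in> B}"
proof (intro equalityI subsetI)
  fix z assume "z \<in> {x * y |x y. x \<in> weight h ` A \<and> y \<in> weight h ` B}"
  then obtain v w where "z = weight h (v @ w)" "v \<in> A" "w \<in> B" by auto
  then show "z \<in> weight h ` {v @ w |v w. v \<in> A \<and> w \<in> B}" by blast
next
  fix z assume "z \<in> weight h ` {v @ w |v w. v \<in> A \<and> w \<in> B}"
  then obtain v w where "z = weight h v * weight h w" "v \<in> A" "w \<in> B" by auto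
  then show "z \<in> {x * y |x y. x \<in> weight h ` A \<and> y \<in> weight h ` B}" by blast
qed

text \<open>By \<open>path_short\<close> and \<open>weight_subseq\<close> each path weight is
  dominated by that of a path shorter than the number of states, and over the finite
  \<open>Y\<close> there are finitely many such words.\<close>

lemma fin_lub_path_ex:
  fixes h :: "'c \<Rightarrow> 'l::integral_l_monoid"
  assumes "finite Y" "finite (states M)" "a \<in> states M"
  shows "\<exists>s. fin_lub (weight h ` {v \<in> lists Y. path M a v b}) s"
proof (rule fin_lub_dominated[where F = "weight h ` {v \<in> lists Y. path M a v b \<and> length v < card (states M)}"])
  have "finite {v. set v \<subseteq> Y \<and> length v \<le> card (states M)}"
    by (rule finite_lists_length_le[OF assms(1)])
  then show "finite (weight h ` {v \<in> lists Y. path M a v b \<and> length v < card (states M)})"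
    by (intro finite_imageI) (erule finite_subset[rotated], auto)
next
  fix x assume "x \<in> weight h ` {v \<in> lists Y. path M a v b}"
  then obtain v where v: "v \<in> lists Y" "path M a v b" "x = weight h v" by blast
  from path_short[OF assms(2,3) v(2)] obtain v' where
    v': "subseq v' v" "length v' < card (states M)" "path M a v' b" by blast
  have "v' \<in> lists Y" using v(1) v'(1) by (auto dest: list_emb_set)
  moreover have "x \<le> weight h v'" using weight_subseq[OF v'(1)] v(3) by simp
  ultimately show "\<exists>y\<in>weight h ` {v \<in> lists Y. path M a v b \<and> length v < card (states M)}. x \<le> y"
    using v' by blast
qed auto

section \<open>The constructed automaton: existence of the suprema and recognized language\<close>

context
  fixes \<alpha> :: "('l::integral_l_monoid, 'c) fre"
    and X Y :: "'c set"
    and p :: "'l \<Rightarrow> 'c"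
    and M :: "('q, 'c, 'l) fuzzy_automaton"
  assumes nd: "nondeterministic_automaton M"
    and alphabet: "alphabet M = X \<union> Y"
    and disjoint: "Y \<inter> X = {}"
begin

abbreviation (input) "wt \<equiv> weight (phi_letter \<alpha> p)"
abbreviation (input) "N \<equiv> automaton_alpha \<alpha> X Y p M"

lemma finite_states: "finite (states M)" and finite_X: "finite X" and finite_Y: "finite Y"
  and init_state: "init M \<in> states M"
  using nd alphabet by (simp_all add: nondeterministic_automaton_def fuzzy_automaton_def)

lemma fuzzy_automaton_alpha: "fuzzy_automaton N"
  by (simp add: fuzzy_automaton_def automaton_alpha_def finite_states finite_X init_state)

text \<open>A path along a word of \<open>U_words X Y [x]\<close> splits at its single letter
  \<open>x\<close>: a path over \<open>Y\<close> to some \<open>c\<close>, a crisp transition from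
  \<open>c\<close> to \<open>d\<close>, and a path over \<open>Y\<close> from \<open>d\<close>.
  There are finitely many pairs \<open>(c, d)\<close>.\<close>

lemma delta_paths_ex:
  assumes "a \<in> states M" "x \<in> X" "b \<in> states M"
  shows "\<exists>s. fin_lub (wt ` {v \<in> U_words X Y [x]. path M a v b}) s"
proof -
  let ?E = "\<lambda>a b. wt ` {v \<in> lists Y. path M a v b}"
  let ?I = "{(c, d) \<in> states M \<times> states M. trans M c x d = 1}"
  let ?V = "\<lambda>c. {v \<in> lists Y. path M a v c}" and ?W = "\<lambda>d. {w \<in> lists Y. path M d w b}"
  let ?S = "\<lambda>(c, d). {s * t |s t. s \<in> {s * t |s t. s \<in> ?E a c \<and> t \<in> wt ` {[x]}} \<and> t \<in> ?E d b}"
  have "\<exists>s. fin_lub (\<Union>i\<in>?I. ?S i) s"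
  proof (rule fin_lub_UN_finite)
    have "finite (states M \<times> states M)" using finite_states by simp
    then show "finite ?I" by (rule finite_subset[rotated]) auto
  next
    fix i assume "i \<in> ?I"
    then obtain c d where i: "i = (c, d)" "c \<in> states M" "d \<in> states M" by auto
    obtain s where "fin_lub (?E a c) s"
      by (rule fin_lub_path_ex[OF finite_Y finite_states assms(1), THEN exE])
    moreover obtain t where "fin_lub (?E d b) t"
      by (rule fin_lub_path_ex[OF finite_Y finite_states i(3), THEN exE])
    ultimately have "fin_lub (?S (c, d)) (s * wt [x] * t)"
      unfolding prod.case image_insert image_empty by (intro fin_lub_mult fin_lub_singleton)
    then show "\<exists>s. fin_lub (?S i) s" using i(1) by blast
  qed
  moreover have "(\<Union>i\<in>?I. ?S i) = wt ` {v \<in> U_words X Y [x]. path M a v b}"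
  proof -
    have "(\<Union>i\<in>?I. ?S i) = wt ` (\<Union>(c, d)\<in>?I. {v @ w |v w. v \<in> {v @ w |v w. v \<in> ?V c \<and> w \<in> {[x]}} \<and> w \<in> ?W d})"
      unfolding image_weight_append image_UN by (intro SUP_cong refl) auto
    also have "(\<Union>(c, d)\<in>?I. {v @ w |v w. v \<in> {v @ w |v w. v \<in> ?V c \<and> w \<in> {[x]}} \<and> w \<in> ?W d}) =
        {v \<in> U_words X Y [x]. path M a v b}" (is "?L = ?R")
    proof (intro equalityI subsetI)
      fix z assume "z \<in> ?L"
      then obtain c d v w where "c \<in> states M" "d \<in> states M" "trans M c x d = 1" "z = v @ x # w"
        "v \<in> ?V c" "w \<in> ?W d" by (auto simp: in_lists_conv_set)
      then show "z \<in> ?R"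
        using assms(1) unfolding U_words_singleton[OF assms(2) disjoint]
        by (auto simp: path_append)
    next
      fix z assume "z \<in> ?R"
      then obtain v w where z: "z = v @ x # w" "v \<in> lists Y" "w \<in> lists Y" "path M a (v @ x # w) b"
        unfolding U_words_singleton[OF assms(2) disjoint] by auto
      then obtain c d where cd: "c \<in> states M" "d \<in> states M" "trans M c x d = 1"
        and paths: "path M a v c" "path M d w b"
        using path_append[OF assms(1)] by auto
      let ?Vx = "{v @ w |v w. v \<in> ?V c \<and> w \<in> {[x]}}"
      have "v @ [x] \<in> ?Vx" using z(2) paths(1) by blast
      moreover have "w \<in> ?W d" using z(3) paths(2) by simp
      ultimately have "(v @ [x]) @ w \<in> {v @ w |v w. v \<in> ?Vx \<and> w \<in> ?W d}" by blast
      then have "z \<in> {v @ w |v w. v \<in> ?Vx \<and> w \<in> ?W d}" using z(1) by simp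
      moreover have "(c, d) \<in> ?I" using cd by simp
      ultimately show "z \<in> ?L" by (intro UN_I[of "(c, d)"]) (simp_all only: prod.case)
    qed
    finally show ?thesis .
  qed
  ultimately show ?thesis by (simp only:)
qed

text \<open>The two families differ at most by \<open>bot\<close>. The first is used to compute with
  paths, the second gives the existence claim for the transition map.\<close>

lemma fin_lub_trans:
  assumes "a \<in> states M" "x \<in> X" "b \<in> states M"
  shows "fin_lub (wt ` {v \<in> U_words X Y [x]. path M a v b}) (trans N a x b)"
    and "fin_lub (delta_family \<alpha> X Y p M a x b) (trans N a x b)"
proof -
  let ?D = "wt ` {v \<in> U_words X Y [x]. path M a v b}"
  have *: "phi_star \<alpha> p v * trans_word M a v b = (if path M a v b then wt v else bot)"
    if "v \<in> U_words X Y [x]" for v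
    using trans_word_path[OF nd _ assms(1,3), of v] U_words_lists[OF that] alphabet
    by (simp add: phi_star_def mult_bot_right)
  obtain s where s: "fin_lub ?D s" using delta_paths_ex[OF assms] by blast
  then have "fin_lub (delta_family \<alpha> X Y p M a x b) s"
    by (rule fin_lub_insert_bot) (force simp: delta_family_def * image_iff)+
  moreover from this have "trans N a x b = s"
    by (simp add: automaton_alpha_def lub_eqI fin_lub_isLub)
  ultimately show "fin_lub ?D (trans N a x b)" "fin_lub (delta_family \<alpha> X Y p M a x b) (trans N a x b)"
    using s by simp_all
qed

lemma fin_lub_final:
  assumes "a \<in> states M"
  shows "fin_lub (wt ` {v \<in> lists Y. accepts M a v}) (final N a)"
    and "fin_lub (tau_family \<alpha> Y p M a) (final N a)"
proof -
  let ?D = "wt ` {v \<in> lists Y. accepts M a v}"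
  have "?D = (\<Union>b\<in>{b \<in> states M. final M b = 1}. wt ` {v \<in> lists Y. path M a v b})"
    by (auto simp: accepts_def)
  moreover have "\<exists>s. fin_lub \<dots> s"
    by (rule fin_lub_UN_finite) (auto simp: finite_states intro!: fin_lub_path_ex finite_Y assms)
  ultimately obtain s where s: "fin_lub ?D s" by metis
  have *: "Sup_fin ((\<lambda>b. phi_star \<alpha> p v * trans_word M a v b * final M b) ` states M) =
      (if accepts M a v then wt v else bot)" if "v \<in> lists Y" for v
  proof -
    have "v \<in> lists (alphabet M)" using that alphabet by (auto simp: in_lists_conv_set)
    then show ?thesis
      using Sup_fin_accepts[OF nd _ assms, of v "phi_star \<alpha> p v"] by (simp add: phi_star_def)
  qed
  have "tau_family \<alpha> Y p M a = (\<lambda>v. if accepts M a v then wt v else bot) ` lists Y"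
    unfolding tau_family_def by (rule image_cong[OF refl *])
  with s have "fin_lub (tau_family \<alpha> Y p M a) s"
    by (elim fin_lub_insert_bot) auto
  moreover from this have "final N a = s"
    by (simp add: automaton_alpha_def lub_eqI fin_lub_isLub)
  ultimately show "fin_lub ?D (final N a)" "fin_lub (tau_family \<alpha> Y p M a) (final N a)"
    using s by simp_all
qed

text \<open>Inserted letters between two letters of \<open>u\<close> can be read by the transition
  before or after them. Such repeated decompositions do no harm, since the union over states
  collects words and joins are idempotent.\<close>

lemma fin_lub_trans_word:
  assumes "a \<in> states M" "u \<in> lists X" "b \<in> states M"
  shows "fin_lub (wt ` {v \<in> run_words X Y u. path M a v b}) (trans_word N a u b)"
  using assms(2,3)
proof (induction u arbitrary: b rule: rev_induct)
  case Nil
  have "{v \<in> run_words X Y []. path M a v b} = (if a = b then {[]} else {})"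
    by (auto simp: run_words_def U_words_def)
  then show ?case by (simp add: trans_word_Nil fin_lub_empty fin_lub_singleton)
next
  case (snoc x u)
  let ?V = "\<lambda>c. {v \<in> run_words X Y u. path M a v c}"
    and ?W = "\<lambda>c. {w \<in> U_words X Y [x]. path M c w b}"
  have states: "states N = states M" by (simp add: automaton_alpha_def)
  have "fin_lub (\<Union>c\<in>states M. {s * t |s t. s \<in> wt ` ?V c \<and> t \<in> wt ` ?W c}) (trans_word N a (u @ [x]) b)"
    unfolding trans_word_snoc states
  proof (rule fin_lub_UN)
    fix c assume "c \<in> states M"
    then show "fin_lub {s * t |s t. s \<in> wt ` ?V c \<and> t \<in> wt ` ?W c} (trans_word N a u c * trans N c x b)"
      using snoc by (intro fin_lub_mult fin_lub_trans) auto
  qed (use finite_states assms(1) in \<open>auto intro!: fin_lub_Sup_fin\<close>)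
  moreover have "(\<Union>c\<in>states M. {v @ w |v w. v \<in> ?V c \<and> w \<in> ?W c}) =
      {v \<in> run_words X Y (u @ [x]). path M a v b}" (is "?L = ?R")
  proof (intro equalityI subsetI)
    fix z assume "z \<in> ?L"
    then show "z \<in> ?R"
      using U_words_append path_append[OF assms(1)] by (fastforce simp: run_words_def)
  next
    fix z assume z: "z \<in> ?R"
    then have "z \<in> U_words X Y (u @ [x])" by (simp add: run_words_def)
    then obtain v w where "z = v @ w" "v \<in> run_words X Y u" "w \<in> U_words X Y [x]"
      by (rule U_words_split)
    then show "z \<in> ?L" using z path_append[OF assms(1)] by fastforce
  qed
  ultimately show ?case by (simp only: image_weight_append flip: image_UN)
qed

text \<open>The final values absorb trailing letters from \<open>Y\<close>. This lifts the
  restriction of \<open>run_words\<close>: for empty \<open>u\<close> all inserted letters are read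
  by the final value of the initial state.\<close>

lemma fin_lub_recognized:
  assumes "u \<in> lists X"
  shows "fin_lub (wt ` {v \<in> U_words X Y u. accepts M (init M) v}) (recognized N u)"
proof -
  let ?V = "\<lambda>c. {v \<in> run_words X Y u. path M (init M) v c}"
    and ?W = "\<lambda>c. {w \<in> lists Y. accepts M c w}"
  have N: "states N = states M" "init N = init M" by (simp_all add: automaton_alpha_def)
  have "fin_lub (\<Union>c\<in>states M. {s * t |s t. s \<in> wt ` ?V c \<and> t \<in> wt ` ?W c}) (recognized N u)"
    unfolding recognized_def N
  proof (rule fin_lub_UN)
    fix c assume "c \<in> states M"
    then show "fin_lub {s * t |s t. s \<in> wt ` ?V c \<and> t \<in> wt ` ?W c}
        (trans_word N (init M) u c * final N c)"
      using assms init_state by (intro fin_lub_mult fin_lub_trans_word fin_lub_final)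
  qed (use finite_states init_state in \<open>auto intro!: fin_lub_Sup_fin\<close>)
  moreover have "(\<Union>c\<in>states M. {v @ w |v w. v \<in> ?V c \<and> w \<in> ?W c}) =
      {v \<in> U_words X Y u. accepts M (init M) v}" (is "?L = ?R")
  proof (intro equalityI subsetI)
    fix z assume "z \<in> ?L"
    then obtain c v w where *: "c \<in> states M" "z = v @ w" "v \<in> ?V c" "w \<in> ?W c" by blast
    \<comment> \<open>Words over \<open>Y\<close> are the words that become empty, so the final part
      is treated as one more factor.\<close>
    then have "z \<in> U_words X Y (u @ [])"
      unfolding *(2) by (intro U_words_append) (auto simp: run_words_def U_words_Nil)
    then show "z \<in> ?R" using * accepts_append[OF init_state] by auto
  next
    fix z assume z: "z \<in> ?R"
    then have "z \<in> U_words X Y (u @ [])" by simp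
    then obtain v w where "z = v @ w" "v \<in> run_words X Y u" "w \<in> U_words X Y []"
      by (rule U_words_split)
    then show "z \<in> ?L" using z accepts_append[OF init_state] unfolding U_words_Nil by fastforce
  qed
  ultimately show ?thesis by (simp only: image_weight_append flip: image_UN)
qed

lemma recognizes_alpha:
  assumes "letters \<alpha> \<subseteq> X" "bij_betw p (scalars \<alpha>) Y"
    and "recognizes M (sem (alpha_R p \<alpha>))"
  shows "recognizes N (sem \<alpha>)"
  unfolding recognizes_def
proof
  fix u assume "u \<in> lists (alphabet N)"
  then have u: "u \<in> lists X" by (simp add: automaton_alpha_def)
  have p: "inj_on p (scalars \<alpha>)" "p ` scalars \<alpha> = Y"
    using assms(2) by (auto simp: bij_betw_def)
  \<comment> \<open>Both sides are shown to be the supremum of this one family. Comparing its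
    values, rather than the accepted words with \<open>lang p \<alpha>\<close>, also covers the
    trivial case \<open>1 = bot\<close>, where those values do not determine the words.\<close>
  let ?T = "(\<lambda>v. wt v * recognized M v) ` U_words X Y u"
  have "fin_lub (weights (phi_letter \<alpha> p) Y (lang p \<alpha>) u) (sem \<alpha> u)"
    by (rule fin_lub_sem[OF assms(1) _ disjoint])
      (use p disjoint in \<open>auto simp: phi_letter_def\<close>)
  \<comment> \<open>Words of \<open>lang p \<alpha>\<close> use only letters from \<open>X\<close>
    and \<open>Y\<close>, which is the extra condition in \<open>U_words\<close>.\<close>
  moreover have "weights (phi_letter \<alpha> p) Y (lang p \<alpha>) u = wt ` {v \<in> U_words X Y u. v \<in> lang p \<alpha>}"
    using lang_lists[of \<alpha> p "X \<union> Y"] assms(1) p(2) unfolding weights_def U_words_def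
    by (intro image_cong) auto
  ultimately have "fin_lub (wt ` {v \<in> U_words X Y u. v \<in> lang p \<alpha>}) (sem \<alpha> u)" by simp
  moreover have "recognized M v = (if v \<in> lang p \<alpha> then 1 else bot)" if "v \<in> U_words X Y u" for v
    using assms(3) alphabet U_words_lists[OF that] by (simp add: recognizes_def sem_alpha_R)
  then have "?T = (\<lambda>v. if v \<in> lang p \<alpha> then wt v else bot) ` U_words X Y u"
    by (intro image_cong) (auto simp: mult_bot_right)
  ultimately have 1: "fin_lub ?T (sem \<alpha> u)"
    by (elim fin_lub_insert_bot) auto
  have "recognized M v = (if accepts M (init M) v then 1 else bot)" if "v \<in> U_words X Y u" for v
    using recognized_accepts[OF nd] U_words_lists[OF that] alphabet by simp
  then have "?T = (\<lambda>v. if accepts M (init M) v then wt v else bot) ` U_words X Y u"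
    by (intro image_cong) (auto simp: mult_bot_right)
  with fin_lub_recognized[OF u] have "fin_lub ?T (recognized N u)"
    by (elim fin_lub_insert_bot) auto
  with 1 show "recognized N u = sem \<alpha> u" by (metis fin_lub_unique)
qed

end

theorem theorem3p7:
  fixes \<alpha> :: "('l::integral_l_monoid, 'c) fre"
    and X Y :: "'c set"
    and p :: "'l \<Rightarrow> 'c"
    and M :: "('q, 'c, 'l) fuzzy_automaton"
  assumes "finite X"
    and "letters \<alpha> \<subseteq> X"
    and "associated_alphabet \<alpha> X Y p"
    and "nondeterministic_automaton M"
    and "alphabet M = X \<union> Y"
    and "recognizes M (sem (alpha_R p \<alpha>))"
  shows "(\<forall>a\<in>states M. \<forall>x\<in>X. \<forall>b\<in>states M. \<exists>s. isLub UNIV (delta_family \<alpha> X Y p M a x b) s) \<and>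
    (\<forall>a\<in>states M. \<exists>s. isLub UNIV (tau_family \<alpha> Y p M a) s) \<and>
    fuzzy_automaton (automaton_alpha \<alpha> X Y p M) \<and>
    recognizes (automaton_alpha \<alpha> X Y p M) (sem \<alpha>)"
proof -
  from assms(3) have "Y \<inter> X = {}" "bij_betw p (scalars \<alpha>) Y"
    by (simp_all add: associated_alphabet_def)
  note M = assms(4,5) this(1)
  show ?thesis
    using fin_lub_isLub[OF fin_lub_trans(2)[OF M]] fin_lub_isLub[OF fin_lub_final(2)[OF M]]
      fuzzy_automaton_alpha[OF M] recognizes_alpha[OF M assms(2) \<open>bij_betw p (scalars \<alpha>) Y\<close> assms(6)]
    by blast
qed

end
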